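(* The permutation class $\mathrm{Av}(1423, 1342)$ is 1-amalgamable.
   Context: A permutation of length $n\ge 1$ is a sequence of all the $n$ distinct numbers of $[n]=\{1,\dots,n\}$; its $i$-th element is denoted $\pi_i$. An embedding of a permutation $\sigma$ of length $k$ into a permutation $\pi$ of length $n$ is a strictly increasing function $f:[k]\to[n]$ such that $\pi_{f(1)},\dots,\pi_{f(k)}$ is order-isomorphic to $\sigma$ (i.e. $\pi_{f(i)}<\pi_{f(j)}$ iff $\sigma_i<\sigma_j$). $\pi$ contains $\sigma$ if such an embedding exists; otherwise $\pi$ avoids $\sigma$. $\mathrm{Av}(\sigma,\rho)$ is the set of all permutations avoiding both $\sigma$ and $\rho$. A permutation class is a set of permutations closed under taking contained permutations. A permutation class $C$ is 1-amalgamable if for any two permutations $\tau_1,\tau_2\in C$ and any mappings $f_1,f_2$, where $f_i$ is an embedding of the singleton permutation $1$ into $\tau_i$, there is a permutation $\sigma\in C$ and mappings $g_1,g_2$ such that $g_i$ is an embedding of $\tau_i$ into $\sigma$ and $g_1\circ f_1=g_2\circ f_2$. *)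

theory Defs
  imports Main
begin

(* A permutation of length n >= 1 is written in one-line notation, as a list. *)
definition is_permutation :: "nat list \<Rightarrow> bool" where
  "is_permutation p \<longleftrightarrow> p \<noteq> [] \<and> distinct p \<and> set p = {1..length p}"

(* Positions are 1-based; entry p i is only meaningful for i in {1..length p}. *)
definition entry :: "nat list \<Rightarrow> nat \<Rightarrow> nat" where
  "entry p i = p ! (i - 1)"

(* A map [k] -> [n] is represented by a total function on nat whose values outside {1..k}
   are irrelevant. *)
definition embedding :: "(nat \<Rightarrow> nat) \<Rightarrow> nat list \<Rightarrow> nat list \<Rightarrow> bool" where
  "embedding f s p \<longleftrightarrow>
     f ` {1..length s} \<subseteq> {1..length p} \<and>
     strict_mono_on {1..length s} f \<and>
     (\<forall>i\<in>{1..length s}. \<forall>j\<in>{1..length s}.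
        entry p (f i) < entry p (f j) \<longleftrightarrow> entry s i < entry s j)"

definition contains :: "nat list \<Rightarrow> nat list \<Rightarrow> bool" where
  "contains p s \<longleftrightarrow> (\<exists>f. embedding f s p)"

abbreviation avoids :: "nat list \<Rightarrow> nat list \<Rightarrow> bool" where
  "avoids p s \<equiv> \<not> contains p s"

definition Av :: "nat list \<Rightarrow> nat list \<Rightarrow> nat list set" where
  "Av s r = {p. is_permutation p \<and> avoids p s \<and> avoids p r}"

definition permutation_class :: "nat list set \<Rightarrow> bool" where
  "permutation_class C \<longleftrightarrow>
     (\<forall>p\<in>C. is_permutation p) \<and>
     (\<forall>p\<in>C. \<forall>s. is_permutation s \<and> contains p s \<longrightarrow> s \<in> C)"

(* Equality of the two compositions is equality as maps on [1] = {1..length [1]}, since values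
   outside the domain carry no information. *)
definition one_amalgamable :: "nat list set \<Rightarrow> bool" where
  "one_amalgamable C \<longleftrightarrow>
     (\<forall>t1\<in>C. \<forall>t2\<in>C. \<forall>f1 f2.
        embedding f1 [1] t1 \<and> embedding f2 [1] t2 \<longrightarrow>
        (\<exists>s\<in>C. \<exists>g1 g2. embedding g1 t1 s \<and> embedding g2 t2 s \<and>
           (\<forall>i\<in>{1..length [1::nat]}. (g1 \<circ> f1) i = (g2 \<circ> f2) i)))"

lemma embedding_comp:
  assumes f: "embedding f s p" and g: "embedding g p q"
  shows "embedding (g \<circ> f) s q"
proof -
  have *: "f i \<in> {1..length p}" if "i \<in> {1..length s}" for i
    using f that unfolding embedding_def by blast
  have "strict_mono_on {1..length s} (g \<circ> f)"
  proof (rule strict_mono_onI)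
    fix i j assume ij: "i \<in> {1..length s}" "j \<in> {1..length s}" "i < j"
    then have "f i < f j"
      using f unfolding embedding_def strict_mono_on_def by blast
    then show "(g \<circ> f) i < (g \<circ> f) j"
      using g *[OF ij(1)] *[OF ij(2)] unfolding embedding_def strict_mono_on_def by simp
  qed
  moreover have "(g \<circ> f) ` {1..length s} \<subseteq> {1..length q}"
    using * g unfolding embedding_def by (metis image_comp image_mono image_subsetI subset_trans)
  moreover have "entry q ((g \<circ> f) i) < entry q ((g \<circ> f) j) \<longleftrightarrow> entry s i < entry s j"
    if "i \<in> {1..length s}" "j \<in> {1..length s}" for i j
    using f g that *[OF that(1)] *[OF that(2)] unfolding embedding_def by simp
  ultimately show ?thesis
    unfolding embedding_def by blast
qed

lemma permutation_class_Av: "permutation_class (Av s r)"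
  unfolding permutation_class_def Av_def contains_def
  using embedding_comp by blast

end

theory Submission
  imports Defs "HOL-Library.Product_Lexorder"
begin

text \<open>
  Draw a permutation as a set of points in the plane and call \<open>p\<close> below \<open>q\<close> if \<open>q\<close> lies to the upper
  right of \<open>p\<close>. Both 1423 and 1342 consist of a point with a pair \<open>b\<close> below \<open>c\<close> and a further point
  \<open>d\<close> above it, where \<open>d\<close> is incomparable to \<open>b\<close> and to \<open>c\<close>; in 1423 the point \<open>d\<close> lies to the upper
  left of the pair, in 1342 to the lower right, and there is no third possibility. So the class is
  determined by the order ``below'' alone: its members are the configurations without such a fork,
  \<open>fork_free_Av\<close>. This is what makes it possible to work with arbitrary finite sets carrying two
  injective coordinates and to return to permutations at the end of each construction, \<open>standardization\<close>.

  Let \<open>S\<close> and \<open>T\<close> be fork-free with marked points \<open>a\<close> and \<open>b\<close>. Two constructions glue them.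

  Inflation. Let \<open>I\<close> be an interval of \<open>S\<close> that contains \<open>a\<close> and has no other point of \<open>S\<close> below it.
  Replacing \<open>I\<close> by any fork-free configuration creates no fork, because outside of its own
  configuration a new point sees exactly what \<open>a\<close> saw outside of \<open>I\<close>, and all of this lies above the
  whole new configuration.
  Hence an amalgam of \<open>I\<close> and \<open>T\<close> yields one of \<open>S\<close> and \<open>T\<close>, \<open>amalgam_inflate\<close>. Call the points
  that are maximal but not minimal caps and all others base points. If \<open>a\<close> is minimal, then \<open>{a}\<close> is
  such an interval; if \<open>a\<close> is any other base point, then its connected component in the
  comparability graph of the base is one, and it is proper since it contains no cap,
  \<open>proper_interval\<close>. By induction on the number of points, only the case remains in which both \<open>a\<close>
  and \<open>b\<close> are caps.

  Merging. The caps form a decreasing sequence, and the part of the base seen by them behaves like a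
  decreasing sequence of blocks. This is a picture on two parallel lines of slope -1, which can be
  cut into unit steps starting at a prescribed cap: there are integer columns and rows such that
  base points lie in cells on one diagonal and caps in cells on the next one, \<open>staircase_exists\<close>.
  Cut \<open>S\<close> at \<open>a\<close> and \<open>T\<close> at \<open>b\<close>, lay the two grids on top of each other, and put \<open>S\<close> to the right of
  \<open>T\<close> in every column and below \<open>T\<close> in every row. Then \<open>a\<close> and \<open>b\<close> can be identified, and the only
  comparabilities between \<open>S\<close> and \<open>T\<close> join a base point to a cap whose cell depends only on the cell
  of the base point; no fork arises, \<open>amalgam_caps\<close>.
\<close>

section \<open>Fork-free point configurations\<close>

definition below :: "('p \<Rightarrow> 'a::linorder) \<Rightarrow> ('p \<Rightarrow> 'b::linorder) \<Rightarrow> 'p \<Rightarrow> 'p \<Rightarrow> bool" where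
  "below X Y p q \<longleftrightarrow> X p < X q \<and> Y p < Y q"

lemma below_trans: "below X Y p q \<Longrightarrow> below X Y q r \<Longrightarrow> below X Y p r"
  by (auto simp: below_def)

lemma below_irrefl [simp]: "\<not> below X Y p p"
  by (auto simp: below_def)

lemma finite_max_key:
  fixes X :: "'p \<Rightarrow> 'a::linorder"
  assumes "finite Z" "Z \<noteq> {}"
  shows "\<exists>z\<in>Z. \<forall>q\<in>Z. X q \<le> X z"
proof -
  have "Max (X ` Z) \<in> X ` Z"
    using assms by simp
  then obtain z where "z \<in> Z" "X z = Max (X ` Z)"
    by auto
  then show ?thesis
    using assms(1) by (intro bexI[of _ z]) auto
qed

text \<open>
  The condition says that the points above any given point form a weak order: for them,
  incomparability is transitive.
\<close>

locale fork_free =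
  fixes X :: "'p \<Rightarrow> 'a::linorder" and Y :: "'p \<Rightarrow> 'b::linorder" and S :: "'p set"
  assumes finite_S: "finite S"
    and inj_X: "inj_on X S"
    and inj_Y: "inj_on Y S"
    and no_fork: "\<lbrakk>p \<in> S; b \<in> S; c \<in> S; d \<in> S;
        below X Y p b; below X Y b c; below X Y p d\<rbrakk> \<Longrightarrow> below X Y b d \<or> below X Y d c"
begin

abbreviation lt (infix "\<prec>" 50) where "p \<prec> q \<equiv> below X Y p q"

definition caps :: "'p set" where
  "caps = {u \<in> S. (\<forall>q\<in>S. \<not> u \<prec> q) \<and> (\<exists>p\<in>S. p \<prec> u)}"

definition base :: "'p set" where
  "base = S - caps"

lemma capsD: "u \<in> caps \<Longrightarrow> u \<in> S" "u \<in> caps \<Longrightarrow> q \<in> S \<Longrightarrow> \<not> u \<prec> q"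
  by (auto simp: caps_def)

lemma baseD: "l \<in> base \<Longrightarrow> l \<in> S" "l \<in> base \<Longrightarrow> l \<notin> caps"
  by (auto simp: base_def)

lemma base_or_caps: "p \<in> S \<Longrightarrow> p \<in> base \<or> p \<in> caps"
  by (auto simp: base_def)

lemma X_eq: "p \<in> S \<Longrightarrow> q \<in> S \<Longrightarrow> X p = X q \<longleftrightarrow> p = q"
  using inj_X by (auto dest: inj_onD)

lemma Y_eq: "p \<in> S \<Longrightarrow> q \<in> S \<Longrightarrow> Y p = Y q \<longleftrightarrow> p = q"
  using inj_Y by (auto dest: inj_onD)

text \<open>
  Below a cap, the base behaves as if it consisted of blocks: \<open>q\<close> has \<open>p\<close> below it, so being a base
  point it is not maximal, and \<open>q \<prec> z\<close> for some \<open>z\<close>. The absence of forks leaves \<open>q \<prec> u\<close> or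
  \<open>u \<prec> z\<close>, and \<open>u\<close> is maximal.
\<close>

lemma below_cap:
  assumes "p \<in> S" "q \<in> base" "u \<in> caps" "p \<prec> q" "p \<prec> u"
  shows "q \<prec> u"
proof -
  obtain z where "z \<in> S" "q \<prec> z"
    using assms by (auto simp: base_def caps_def)
  then show ?thesis
    using no_fork[of p q z u] assms capsD baseD by blast
qed

lemma cap_not_above:
  assumes "u \<in> caps" "q \<in> S" "q \<noteq> u"
  shows "Y u \<le> Y q \<Longrightarrow> X q < X u" "X u \<le> X q \<Longrightarrow> Y q < Y u"
proof -
  have "X u \<noteq> X q" "Y u \<noteq> Y q" "\<not> u \<prec> q"
    using assms X_eq Y_eq capsD by blast+
  then show "Y u \<le> Y q \<Longrightarrow> X q < X u" "X u \<le> X q \<Longrightarrow> Y q < Y u"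
    by (auto simp: below_def)
qed

text \<open>
  Reflection in the diagonal, which is inversion of permutations. It turns the downward half of the
  staircase below into its upward half.
\<close>

lemma fork_free_swap: "fork_free Y X S"
  using no_fork by unfold_locales (auto simp: finite_S inj_X inj_Y below_def conj_commute)

lemma caps_swap: "fork_free.caps Y X S = caps"
  by (simp add: fork_free.caps_def[OF fork_free_swap] caps_def below_def conj_commute)

lemma base_swap: "fork_free.base Y X S = base"
  by (simp add: fork_free.base_def[OF fork_free_swap] base_def caps_swap)

end

lemma fork_free_subset: "fork_free X Y S \<Longrightarrow> I \<subseteq> S \<Longrightarrow> fork_free X Y I"
  unfolding fork_free_def by (meson finite_subset inj_on_subset subsetD)


section \<open>Staircase gridding\<close>

context fork_free
begin

definition left_of :: "'p set \<Rightarrow> 'p set" where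
  "left_of L = {p \<in> S. \<exists>l\<in>L. X p \<le> X l}"

definition above :: "'p set \<Rightarrow> 'p set" where
  "above U = {p \<in> S. \<exists>u\<in>U. Y u \<le> Y p}"

text \<open>
  The staircase climbing to the upper left from a horizontal line, \<open>B\<close> being the set of points above
  that line: \<open>stair B j\<close> is what lies above the \<open>j\<close>-th horizontal line. The next vertical line passes
  through the rightmost base point above the current horizontal line, and the next horizontal line
  passes through the lowest cap to the left of that vertical line, so each line is placed as late as
  the points already cut off permit.
\<close>

primrec stair :: "'p set \<Rightarrow> nat \<Rightarrow> 'p set" where
  "stair B 0 = B"
| "stair B (Suc j) = above (caps \<inter> left_of (base \<inter> stair B j))"

text \<open>
  Half of the gridding: \<open>c\<close> and \<open>r\<close> count the vertical and horizontal lines that a point has passed.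
  A base point passes the same number of lines of both kinds and a cap above the initial line passes
  one more horizontal line. The assumptions are the invariants of the staircase at its start. The
  invariant \<open>down\<close> keeps base points that are comparable to each other together.
\<close>

lemma stair_grid:
  assumes B: "B \<subseteq> S" and up: "\<And>p q. p \<in> B \<Longrightarrow> q \<in> S \<Longrightarrow> Y p \<le> Y q \<Longrightarrow> q \<in> B"
    and down: "\<And>l l'. l \<in> base \<inter> B \<Longrightarrow> l' \<in> base \<Longrightarrow> l' \<prec> l \<Longrightarrow> l' \<in> B"
    and cut: "caps \<inter> left_of (base \<inter> B) \<subseteq> B"
  obtains c r :: "'p \<Rightarrow> nat" where
    "\<And>p q. p \<in> S \<Longrightarrow> q \<in> S \<Longrightarrow> X p < X q \<Longrightarrow> c q \<le> c p"
    "\<And>p q. p \<in> S \<Longrightarrow> q \<in> S \<Longrightarrow> Y p < Y q \<Longrightarrow> r p \<le> r q"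
    "\<And>p. p \<in> base \<Longrightarrow> r p = c p"
    "\<And>p. p \<in> caps \<inter> B \<Longrightarrow> r p = Suc (c p)"
    "\<And>p. p \<in> caps - B \<Longrightarrow> r p = 0 \<and> c p = 0"
    "\<And>p. 0 < c p \<Longrightarrow> p \<in> left_of (base \<inter> B)"
    "\<And>p. 0 < r p \<longleftrightarrow> p \<in> B"
proof -
  \<comment> \<open>\<open>D j\<close> is above the \<open>j\<close>-th horizontal line, \<open>A j\<close> left of the vertical line that follows it.\<close>
  define D where "D = stair B"
  define A where "A = (\<lambda>j. left_of (base \<inter> D j))"
  have D0: "D 0 = B" and DS: "D (Suc j) = above (caps \<inter> A j)" for j
    by (simp_all add: D_def A_def)
  have D_sub: "D j \<subseteq> S" for j
    by (cases j) (use B in \<open>auto simp: D0 DS above_def\<close>)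
  have D_up: "q \<in> D j" if "p \<in> D j" "q \<in> S" "Y p \<le> Y q" for p q j
    by (cases j) (use that up order_trans in \<open>auto simp: D0 DS above_def\<close>, blast)
  have A_left: "q \<in> A j" if "p \<in> A j" "q \<in> S" "X q \<le> X p" for p q j
    using that by (auto simp: A_def left_of_def intro: order_trans)
  have left_mono: "left_of L \<subseteq> left_of L'" if "L \<subseteq> L'" for L L'
    using that by (auto simp: left_of_def)
  have D_Suc: "D (Suc j) \<subseteq> D j" for j
  proof (induction j)
    case 0
    show ?case
      using cut up by (auto simp: D0 DS A_def above_def)
  next
    case (Suc j)
    then have "A (Suc j) \<subseteq> A j"
      using left_mono[of "base \<inter> D (Suc j)" "base \<inter> D j"] by (auto simp: A_def)
    then show ?case
      by (auto simp: DS above_def)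
  qed
  have D_anti: "D j \<subseteq> D i" if "i \<le> j" for i j
    using D_Suc that by (rule lift_Suc_antimono_le)
  have A_anti: "A j \<subseteq> A i" if "i \<le> j" for i j
    unfolding A_def using D_anti[OF that] by (intro left_mono) auto
  \<comment> \<open>If the line through the cap \<open>u\<close> separated \<open>l'\<close> from \<open>l\<close>, then \<open>u\<close> would be above \<open>l'\<close> and hence above \<open>l\<close>.\<close>
  have D_down: "l' \<in> D j" if l: "l \<in> base" "l \<in> D j" "l' \<in> base" "l' \<prec> l" for l l' j
  proof (cases j)
    case 0
    then show ?thesis using down l by (auto simp: D0)
  next
    case (Suc i)
    then obtain u where u: "u \<in> caps" "u \<in> A i" "Y u \<le> Y l"
      using l by (auto simp: DS above_def)
    have "X l < X u"
      using cap_not_above(1)[of u l] u l baseD by blast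
    have "\<not> Y l' < Y u"
    proof
      assume "Y l' < Y u"
      then have "l' \<prec> u"
        using \<open>X l < X u\<close> l(4) by (auto simp: below_def)
      then have "l \<prec> u"
        using below_cap[of l' l u] l u baseD by blast
      then show False
        using u by (auto simp: below_def)
    qed
    then have "Y u \<le> Y l'" by simp
    then show ?thesis
      using u l(3) baseD(1)[OF l(3)] unfolding Suc DS above_def by blast
  qed
  have base_eq: "p \<in> A j \<longleftrightarrow> p \<in> D j" if p: "p \<in> base" for p j
  proof
    assume "p \<in> A j"
    then obtain l where l: "l \<in> base" "l \<in> D j" "X p \<le> X l"
      by (auto simp: A_def left_of_def)
    show "p \<in> D j"
    proof (cases "Y l \<le> Y p")
      case True
      then show ?thesis using D_up l p baseD by blast
    next
      case False
      then have "p \<prec> l"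
        using l p X_eq[of p l] baseD by (auto simp: below_def order.strict_iff_order)
      then show ?thesis using D_down l p by blast
    qed
  next
    assume "p \<in> D j"
    then show "p \<in> A j"
      using p baseD by (auto simp: A_def left_of_def)
  qed
  have caps_eq: "p \<in> D (Suc j) \<longleftrightarrow> p \<in> A j" if p: "p \<in> caps" for p j
  proof
    assume "p \<in> D (Suc j)"
    then obtain u where u: "u \<in> caps" "u \<in> A j" "Y u \<le> Y p"
      by (auto simp: DS above_def)
    then have "X p \<le> X u"
      using cap_not_above(1)[of u p] p capsD by fastforce
    then show "p \<in> A j"
      using A_left u p capsD by blast
  next
    assume "p \<in> A j"
    then show "p \<in> D (Suc j)"
      using p capsD by (auto simp: DS above_def)
  qed
  \<comment> \<open>The staircase stops: the rightmost base point of \<open>D j\<close> is cut off from \<open>A (Suc j)\<close>, as otherwise some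
    cap in \<open>A j\<close> would lie to the lower left of it. So every point passes finitely many lines.\<close>
  have A_strict: "A (Suc j) \<noteq> A j" if ne: "A j \<noteq> {}" for j
  proof -
    have "base \<inter> D j \<noteq> {}" "finite (base \<inter> D j)"
      using ne finite_S by (auto simp: A_def left_of_def base_def)
    then obtain l where l: "l \<in> base" "l \<in> D j"
      and l_max: "\<And>l'. l' \<in> base \<Longrightarrow> l' \<in> D j \<Longrightarrow> X l' \<le> X l"
      using finite_max_key[of "base \<inter> D j" X] by blast
    have "l \<in> A j"
      using l base_eq by blast
    moreover have "l \<notin> A (Suc j)"
    proof
      assume "l \<in> A (Suc j)"
      then have "l \<in> D (Suc j)"
        using l base_eq by blast
      then obtain u where u: "u \<in> caps" "u \<in> A j" "Y u \<le> Y l"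
        by (auto simp: DS above_def)
      then have "X u \<le> X l"
        using l_max by (auto simp: A_def left_of_def intro: order_trans)
      moreover have "X l < X u"
        using cap_not_above(1)[of u l] u l baseD by blast
      ultimately show False by simp
    qed
    ultimately show ?thesis by blast
  qed
  have A_card: "A j = {} \<or> card (A j) + j \<le> card S" for j
  proof (induction j)
    case 0
    show ?case using finite_S by (auto simp: A_def left_of_def intro: card_mono)
  next
    case (Suc j)
    show ?case
    proof (cases "A j = {}")
      case True
      then show ?thesis using A_anti[of j "Suc j"] by auto
    next
      case False
      have "finite (A j)"
        using finite_S by (auto simp: A_def left_of_def)
      then have "card (A (Suc j)) < card (A j)"
        using A_strict[OF False] A_anti[of j "Suc j"] by (intro psubset_card_mono) auto
      then show ?thesis using Suc False by auto
    qed
  qed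
  have finA: "finite {j. p \<in> A j}" for p
  proof (rule finite_subset)
    show "{j. p \<in> A j} \<subseteq> {..card S}"
      using A_card by (auto dest: add_leD2)
  qed simp
  have D_split: "{j. p \<in> D j} \<subseteq> insert 0 (Suc ` {j. p \<in> D (Suc j)})" for p
  proof
    fix j assume "j \<in> {j. p \<in> D j}"
    then show "j \<in> insert 0 (Suc ` {j. p \<in> D (Suc j)})"
      by (cases j) auto
  qed
  have finD: "finite {j. p \<in> D j}" if "p \<in> S" for p
  proof (cases "p \<in> base")
    case True
    then show ?thesis using finA[of p] by (simp add: base_eq)
  next
    case False
    then have "{j. p \<in> D (Suc j)} = {j. p \<in> A j}"
      using caps_eq that base_or_caps by blast
    then show ?thesis
      using D_split[of p] finA by (auto intro: finite_subset)
  qed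
  define c where "c = (\<lambda>p. card {j. p \<in> A j})"
  define r where "r = (\<lambda>p. card {j. p \<in> D j})"
  show ?thesis
  proof (rule that[of c r])
    show "c q \<le> c p" if "p \<in> S" "q \<in> S" "X p < X q" for p q
      unfolding c_def using that A_left finA by (intro card_mono) (auto simp: less_imp_le)
    show "r p \<le> r q" if "p \<in> S" "q \<in> S" "Y p < Y q" for p q
      unfolding r_def using that D_up finD by (intro card_mono) (auto simp: less_imp_le)
    show "r p = c p" if "p \<in> base" for p
      using base_eq[OF that] by (simp add: c_def r_def)
    show "r p = Suc (c p)" if p: "p \<in> caps \<inter> B" for p
    proof -
      have "{j. p \<in> D j} = insert 0 (Suc ` {j. p \<in> A j})"
        using D_split[of p] caps_eq p D0 by auto
      then show ?thesis
        using finA by (simp add: c_def r_def card_image)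
    qed
    show "r p = 0 \<and> c p = 0" if p: "p \<in> caps - B" for p
    proof -
      have "p \<notin> D j" for j
        using p D_anti[of 0 j] D0 by auto
      then show ?thesis
        using p caps_eq[of p] by (simp add: c_def r_def)
    qed
    show "p \<in> left_of (base \<inter> B)" if pos: "0 < c p" for p
    proof -
      obtain j where "p \<in> A j"
        using pos by (auto simp: c_def card_gt_0_iff)
      then show ?thesis
        using A_anti[of 0 j] by (auto simp: A_def D0)
    qed
    show "0 < r p \<longleftrightarrow> p \<in> B" for p
    proof
      assume "0 < r p"
      then obtain j where "p \<in> D j"
        by (auto simp: r_def card_gt_0_iff)
      then show "p \<in> B"
        using D_anti[of 0 j] by (auto simp: D0)
    next
      assume "p \<in> B"
      then have "0 \<in> {j. p \<in> D j}" "finite {j. p \<in> D j}"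
        using B finD D0 by auto
      then show "0 < r p"
        unfolding r_def card_gt_0_iff by blast
    qed
  qed
qed

text \<open>
  Columns are numbered from right to left and rows from bottom to top, so that a base point lies in a
  diagonal cell and a cap in the cell on top of a diagonal cell.
\<close>

definition row :: "('p \<Rightarrow> int) \<Rightarrow> 'p \<Rightarrow> int" where
  "row k p = k p + of_bool (p \<in> caps)"

text \<open>
  The last conjunct places \<open>a\<close> in the bottom right corner of its cell: \<open>a\<close> is the rightmost point of
  column 0 and the lowest point of row 1.
\<close>

definition staircase :: "('p \<Rightarrow> int) \<Rightarrow> 'p \<Rightarrow> bool" where
  "staircase k a \<longleftrightarrow>
     (\<forall>p\<in>S. \<forall>q\<in>S. X p < X q \<longrightarrow> k q \<le> k p) \<and>
     (\<forall>p\<in>S. \<forall>q\<in>S. Y p < Y q \<longrightarrow> row k p \<le> row k q) \<and>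
     k a = 0 \<and>
     (\<forall>p\<in>S. (0 \<le> k p \<longleftrightarrow> X p \<le> X a) \<and> (1 \<le> row k p \<longleftrightarrow> Y a \<le> Y p))"

text \<open>
  The lines to the upper left of \<open>a\<close> come from a staircase starting with the horizontal line just
  below \<open>a\<close>, those to the lower right from the reflection of a staircase starting with the vertical
  line just to the right of \<open>a\<close>. Either staircase gives the number 0 to the points on the other side
  of its first line, so the column is the difference of the two counts.
\<close>

lemma staircase_exists:
  assumes a: "a \<in> caps"
  shows "\<exists>k. staircase k a"
proof -
  note aS = capsD(1)[OF a]
  have base_a: "X l < X a \<or> Y l < Y a" if "l \<in> base" for l
    using cap_not_above(1)[OF a, of l] a that baseD by (cases "Y a \<le> Y l") auto
  have caps_a: "X u \<le> X a \<longleftrightarrow> Y a \<le> Y u" if "u \<in> caps" for u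
    using cap_not_above[OF a, of u] cap_not_above[OF that, of a] that aS capsD
    by (metis linorder_not_less order.strict_iff_order)
  define B where "B = {p \<in> S. Y a \<le> Y p}"
  define B' where "B' = {p \<in> S. X a < X p}"
  interpret swapped: fork_free Y X S
    by (rule fork_free_swap)
  have base_B: "X l < X a" if "l \<in> base \<inter> B" for l
    using base_a[of l] that by (auto simp: B_def)
  have base_B': "Y l < Y a" if "l \<in> base \<inter> B'" for l
    using base_a[of l] that by (auto simp: B'_def)
  obtain c r where up:
    "\<And>p q. p \<in> S \<Longrightarrow> q \<in> S \<Longrightarrow> X p < X q \<Longrightarrow> c q \<le> c p"
    "\<And>p q. p \<in> S \<Longrightarrow> q \<in> S \<Longrightarrow> Y p < Y q \<Longrightarrow> r p \<le> r q"
    "\<And>p. p \<in> base \<Longrightarrow> r p = c p"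
    "\<And>p. p \<in> caps \<inter> B \<Longrightarrow> r p = Suc (c p)"
    "\<And>p. p \<in> caps - B \<Longrightarrow> r p = 0 \<and> c p = 0"
    "\<And>p. 0 < c p \<Longrightarrow> p \<in> left_of (base \<inter> B)"
    "\<And>p. 0 < r p \<longleftrightarrow> p \<in> B"
  proof (rule stair_grid[of B])
    show "l' \<in> B" if "l \<in> base \<inter> B" "l' \<in> base" "l' \<prec> l" for l l'
    proof -
      have "\<not> Y l' < Y a"
      proof
        assume "Y l' < Y a"
        then have "l' \<prec> a"
          using that base_B[of l] by (auto simp: below_def)
        then have "l \<prec> a"
          using below_cap[of l' l a] a that baseD by blast
        then show False using that by (auto simp: below_def B_def)
      qed
      then show ?thesis using that baseD by (auto simp: B_def)
    qed
    show "caps \<inter> left_of (base \<inter> B) \<subseteq> B"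
      using base_B caps_a capsD by (fastforce simp: left_of_def B_def)
  qed (auto simp: B_def intro: order_trans)
  obtain c' r' where down:
    "\<And>p q. p \<in> S \<Longrightarrow> q \<in> S \<Longrightarrow> Y p < Y q \<Longrightarrow> c' q \<le> c' p"
    "\<And>p q. p \<in> S \<Longrightarrow> q \<in> S \<Longrightarrow> X p < X q \<Longrightarrow> r' p \<le> r' q"
    "\<And>p. p \<in> base \<Longrightarrow> r' p = c' p"
    "\<And>p. p \<in> caps \<inter> B' \<Longrightarrow> r' p = Suc (c' p)"
    "\<And>p. p \<in> caps - B' \<Longrightarrow> r' p = 0 \<and> c' p = 0"
    "\<And>p. 0 < c' p \<Longrightarrow> p \<in> swapped.left_of (base \<inter> B')"
    "\<And>p. 0 < r' p \<longleftrightarrow> p \<in> B'"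
  proof (rule swapped.stair_grid[of B', unfolded caps_swap base_swap])
    show "l' \<in> B'" if "l \<in> base \<inter> B'" "l' \<in> base" "swapped.lt l' l" for l l'
    proof -
      have "\<not> X l' \<le> X a"
      proof
        assume "X l' \<le> X a"
        then have "X l' < X a"
          using X_eq[of l' a] a that aS baseD by (auto simp: order.strict_iff_order)
        then have "l' \<prec> a" "l' \<prec> l"
          using that base_B'[of l] by (auto simp: below_def)
        then have "l \<prec> a"
          using below_cap[of l' l a] a that baseD by blast
        then show False using that by (auto simp: below_def B'_def)
      qed
      then show ?thesis using that baseD by (auto simp: B'_def)
    qed
    show "caps \<inter> swapped.left_of (base \<inter> B') \<subseteq> B'"
      using base_B' caps_a capsD by (fastforce simp: swapped.left_of_def B'_def)
  qed (auto simp: B'_def intro: less_le_trans)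
  define k :: "'p \<Rightarrow> int" where "k = (\<lambda>p. int (c p) - int (r' p))"
  have row_k: "row k p = int (r p) - int (c' p)" if "p \<in> S" for p
  proof (cases "p \<in> base")
    case True
    then show ?thesis
      using up(3)[of p] down(3)[of p] baseD by (simp add: row_def k_def)
  next
    case False
    then have p: "p \<in> caps" using that base_or_caps by blast
    then have "p \<in> B \<longleftrightarrow> p \<notin> B'"
      using caps_a[of p] that by (auto simp: B_def B'_def)
    then show ?thesis
      using up(4,5)[of p] down(4,5)[of p] p by (cases "p \<in> B") (auto simp: row_def k_def)
  qed
  have c_pos: "X p < X a" if "0 < c p" for p
    using up(6)[OF that] base_B by (fastforce simp: left_of_def)
  have c'_pos: "Y p < Y a" if "0 < c' p" for p
    using down(6)[OF that] base_B' by (fastforce simp: swapped.left_of_def)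
  have "k q \<le> k p" if "p \<in> S" "q \<in> S" "X p < X q" for p q
    using up(1)[OF that] down(2)[OF that] by (simp add: k_def)
  moreover have "row k p \<le> row k q" if "p \<in> S" "q \<in> S" "Y p < Y q" for p q
    using up(2)[OF that] down(1)[OF that] that by (simp add: row_k)
  moreover have "k a = 0"
    using c_pos[of a] down(7)[of a] by (auto simp: k_def B'_def)
  moreover have "0 \<le> k p \<longleftrightarrow> X p \<le> X a" if "p \<in> S" for p
    using c_pos[of p] down(7)[of p] that by (cases "X p \<le> X a") (auto simp: k_def B'_def)
  moreover have "1 \<le> row k p \<longleftrightarrow> Y a \<le> Y p" if "p \<in> S" for p
    using c'_pos[of p] up(7)[of p] that
    by (cases "Y a \<le> Y p"; cases "c' p") (auto simp: row_k B_def)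
  ultimately show ?thesis
    unfolding staircase_def by blast
qed

text \<open>
  A point below a base point is a base point too. On the diagonal, row and column numbers agree, and
  the upper right point has the smaller or equal column number but the larger or equal row number.
\<close>

lemma same_level:
  assumes "staircase k a" and pq: "p \<in> S" "q \<in> S" "p \<prec> q" "q \<notin> caps"
  shows "k q = k p"
proof -
  have "p \<notin> caps"
    using capsD(2) pq by blast
  then have "row k p = k p" "row k q = k q"
    using pq by (simp_all add: row_def)
  moreover have "k q \<le> k p" "row k p \<le> row k q"
    using assms by (auto simp: staircase_def below_def)
  ultimately show ?thesis by simp
qed

end


section \<open>Permutations as fork-free configurations\<close>

definition embeds ::
  "('p \<Rightarrow> 'a::linorder) \<Rightarrow> ('p \<Rightarrow> 'b::linorder) \<Rightarrow> 'p set \<Rightarrow>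
   ('q \<Rightarrow> 'c::linorder) \<Rightarrow> ('q \<Rightarrow> 'd::linorder) \<Rightarrow> 'q set \<Rightarrow> ('p \<Rightarrow> 'q) \<Rightarrow> bool" where
  "embeds X Y S X' Y' T f \<longleftrightarrow> f ` S \<subseteq> T \<and>
     (\<forall>p\<in>S. \<forall>q\<in>S. (X p < X q \<longleftrightarrow> X' (f p) < X' (f q)) \<and> (Y p < Y q \<longleftrightarrow> Y' (f p) < Y' (f q)))"

lemma embeds_comp:
  "embeds X Y S X' Y' T f \<Longrightarrow> embeds X' Y' T X'' Y'' U g \<Longrightarrow> embeds X Y S X'' Y'' U (g \<circ> f)"
  unfolding embeds_def by (simp add: image_subset_iff)

lemma embeds_below:
  "embeds X Y S X' Y' T f \<Longrightarrow> p \<in> S \<Longrightarrow> q \<in> S \<Longrightarrow> below X' Y' (f p) (f q) \<longleftrightarrow> below X Y p q"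
  by (auto simp: embeds_def below_def)

lemma embedding_iff_embeds:
  "embedding f s p \<longleftrightarrow> embeds id (entry s) {1..length s} id (entry p) {1..length p} f"
proof -
  have "strict_mono_on A f \<longleftrightarrow> (\<forall>i\<in>A. \<forall>j\<in>A. i < j \<longleftrightarrow> f i < f j)" for A :: "nat set"
    by (metis strict_mono_on_def strict_mono_on_less)
  then show ?thesis
    unfolding embedding_def embeds_def by auto
qed

lemma inj_on_entry: "distinct p \<Longrightarrow> inj_on (entry p) {1..length p}"
  by (auto simp: inj_on_def entry_def nth_eq_iff_index_eq)

lemma entry_four:
  "entry [v1, v2, v3, v4] 1 = v1" "entry [v1, v2, v3, v4] (Suc 0) = v1"
  "entry [v1, v2, v3, v4] 2 = v2" "entry [v1, v2, v3, v4] 3 = v3" "entry [v1, v2, v3, v4] 4 = v4"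
  by (simp_all add: entry_def)

lemma positions_four: "{1..length [v1, v2, v3, v4]} = {1, 2, 3, 4}"
  by (auto simp: numeral_eq_Suc)

text \<open>
  For a fork \<open>a \<prec> b \<prec> c\<close>, \<open>a \<prec> d\<close> the point \<open>d\<close> lies either to the upper left of both \<open>b\<close> and \<open>c\<close> or to
  the lower right of both, and the four points form 1423 or 1342 respectively.
\<close>

lemma fork_free_Av:
  assumes "is_permutation p"
  shows "p \<in> Av [1, 4, 2, 3] [1, 3, 4, 2] \<longleftrightarrow> fork_free id (entry p) {1..length p}"
proof
  assume p: "p \<in> Av [1, 4, 2, 3] [1, 3, 4, 2]"
  have inj: "inj_on (entry p) {1..length p}"
    using assms inj_on_entry by (auto simp: is_permutation_def)
  have emb: "embedding (entry [i1, i2, i3, i4]) [v1, v2, v3, v4] p"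
    if i: "i1 < i2" "i2 < i3" "i3 < i4" "i1 \<in> {1..length p}" "i4 \<in> {1..length p}"
      and v: "\<forall>(i, x)\<in>{(i1, v1), (i2, v2), (i3, v3), (i4, v4)}.
        \<forall>(j, y)\<in>{(i1, v1), (i2, v2), (i3, v3), (i4, v4)}.
          entry p i < entry p j \<longleftrightarrow> x < y"
    for i1 i2 i3 i4 v1 v2 v3 v4
    unfolding embedding_def positions_four
  proof (intro conjI)
    show "entry [i1, i2, i3, i4] ` {1, 2, 3, 4} \<subseteq> {1..length p}"
      using i by (simp add: entry_four)
    show "strict_mono_on {1, 2, 3, 4} (entry [i1, i2, i3, i4])"
      using i by (auto intro!: strict_mono_onI simp: entry_four)
    show "\<forall>i\<in>{1, 2, 3, 4}. \<forall>j\<in>{1, 2, 3, 4}.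
        entry p (entry [i1, i2, i3, i4] i) < entry p (entry [i1, i2, i3, i4] j) \<longleftrightarrow>
        entry [v1, v2, v3, v4] i < entry [v1, v2, v3, v4] j"
      using v by (simp add: entry_four)
  qed
  show "fork_free id (entry p) {1..length p}"
  proof unfold_locales
    fix a b c d
    assume S: "a \<in> {1..length p}" "b \<in> {1..length p}" "c \<in> {1..length p}" "d \<in> {1..length p}"
      and ab: "below id (entry p) a b" and bc: "below id (entry p) b c"
      and ad: "below id (entry p) a d"
    show "below id (entry p) b d \<or> below id (entry p) d c"
    proof (rule ccontr)
      assume neg: "\<not> ?thesis"
      then have "b \<noteq> d" "c \<noteq> d" using bc by auto
      then have ne: "entry p b \<noteq> entry p d" "entry p c \<noteq> entry p d"
        using inj S by (auto dest: inj_onD)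
      show False
      proof (cases "d < b")
        \<comment> \<open>A point \<open>d\<close> to the left of \<open>b\<close> must exceed both \<open>b\<close> and \<open>c\<close>, since it is not below \<open>c\<close>.\<close>
        case True
        then have "embedding (entry [a, d, b, c]) [1, 4, 2, 3] p"
          using neg ab bc ad S ne by (intro emb) (auto simp: below_def)
        then show False using p by (auto simp: Av_def contains_def)
      next
        case False
        \<comment> \<open>Now \<open>d\<close> is less than both, since it is not above \<open>b\<close>, and this forces it to the right of \<open>c\<close>.\<close>
        then have "embedding (entry [a, b, c, d]) [1, 3, 4, 2] p"
          using neg ab bc ad S ne \<open>b \<noteq> d\<close> \<open>c \<noteq> d\<close> by (intro emb) (auto simp: below_def)
        then show False using p by (auto simp: Av_def contains_def)
      qed
    qed
  qed (use inj in auto)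
next
  assume "fork_free id (entry p) {1..length p}"
  then interpret fork_free id "entry p" "{1..length p}" .
  have "\<not> embedding f [1, 4, 2, 3] p" for f
  proof
    assume "embedding f [1, 4, 2, 3] p"
    then have f: "embeds id (entry [1, 4, 2, 3]) {1, 2, 3, 4} id (entry p) {1..length p} f"
      unfolding embedding_iff_embeds positions_four .
    then have "f ` {1, 2, 3, 4} \<subseteq> {1..length p}"
      by (simp add: embeds_def)
    then show False
      using no_fork[of "f 1" "f 3" "f 4" "f 2"]
      by (simp add: embeds_below[OF f]) (simp add: below_def entry_four)
  qed
  moreover have "\<not> embedding f [1, 3, 4, 2] p" for f
  proof
    assume "embedding f [1, 3, 4, 2] p"
    then have f: "embeds id (entry [1, 3, 4, 2]) {1, 2, 3, 4} id (entry p) {1..length p} f"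
      unfolding embedding_iff_embeds positions_four .
    then have "f ` {1, 2, 3, 4} \<subseteq> {1..length p}"
      by (simp add: embeds_def)
    then show False
      using no_fork[of "f 1" "f 2" "f 3" "f 4"]
      by (simp add: embeds_below[OF f]) (simp add: below_def entry_four)
  qed
  ultimately show "p \<in> Av [1, 4, 2, 3] [1, 3, 4, 2]"
    using assms by (auto simp: Av_def contains_def)
qed

definition rank :: "('p \<Rightarrow> 'a::linorder) \<Rightarrow> 'p set \<Rightarrow> 'p \<Rightarrow> nat" where
  "rank X S p = card {q \<in> S. X q \<le> X p}"

lemma rank_less_iff:
  assumes "finite S" "p \<in> S" "q \<in> S"
  shows "rank X S p < rank X S q \<longleftrightarrow> X p < X q"
proof (cases "X p < X q")
  case True
  then have "{r \<in> S. X r \<le> X p} \<subseteq> {r \<in> S. X r \<le> X q}"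
    "q \<in> {r \<in> S. X r \<le> X q} - {r \<in> S. X r \<le> X p}"
    using assms by auto
  then have "{r \<in> S. X r \<le> X p} \<subset> {r \<in> S. X r \<le> X q}"
    by blast
  then show ?thesis
    using True assms by (auto simp: rank_def intro: psubset_card_mono)
next
  case False
  then have "{r \<in> S. X r \<le> X q} \<subseteq> {r \<in> S. X r \<le> X p}"
    by auto
  then show ?thesis
    using False assms card_mono[of "{r \<in> S. X r \<le> X p}" "{r \<in> S. X r \<le> X q}"]
    by (simp add: rank_def)
qed

lemma bij_betw_rank:
  assumes "finite S" "inj_on X S"
  shows "bij_betw (rank X S) S {1..card S}"
proof -
  have "inj_on (rank X S) S"
  proof (rule inj_onI)
    fix p q assume "p \<in> S" "q \<in> S" "rank X S p = rank X S q"
    then have "X p = X q"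
      using rank_less_iff[of S p q X] rank_less_iff[of S q p X] assms(1) by auto
    then show "p = q"
      using assms(2) \<open>p \<in> S\<close> \<open>q \<in> S\<close> by (auto dest: inj_onD)
  qed
  moreover have "rank X S ` S \<subseteq> {1..card S}"
    using assms(1) by (auto simp: rank_def card_gt_0_iff Suc_le_eq intro!: card_mono)
  ultimately show ?thesis
    by (simp add: bij_betw_def card_image card_subset_eq)
qed

text \<open>
  Replacing both coordinates by their ranks turns a configuration into a permutation. Hence amalgams
  may be built with coordinates in any linear orders, in particular in lexicographic products.
\<close>

lemma standardization:
  assumes R: "fork_free X Y R" and ne: "R \<noteq> {}"
  obtains w h where "w \<in> Av [1, 4, 2, 3] [1, 3, 4, 2]"
    "embeds X Y R id (entry w) {1..length w} h"
proof -
  interpret fork_free X Y R by (rule R)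
  define n where "n = card R"
  define h where "h = rank X R"
  define w where "w = map (\<lambda>i. rank Y R (inv_into R h (Suc i))) [0..<n]"
  have h: "bij_betw h R {1..n}" and hY: "bij_betw (rank Y R) R {1..n}"
    using bij_betw_rank finite_S inj_X inj_Y by (auto simp: h_def n_def)
  have len: "length w = n" by (simp add: w_def)
  have inv: "bij_betw (inv_into R h) {1..n} R"
    using h by (rule bij_betw_inv_into)
  have entry_w: "entry w i = rank Y R (inv_into R h i)" if "i \<in> {1..n}" for i
    using that by (auto simp: entry_def w_def)
  have entry_bij: "bij_betw (entry w) {1..n} {1..n}"
    using bij_betw_trans[OF inv hY] by (rule bij_betw_cong[THEN iffD1, rotated]) (simp add: entry_w)
  have "set w = entry w ` {1..n}"
    using len by (force simp: entry_def set_conv_nth image_iff Bex_def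
      intro: exI[of _ "Suc _"])
  then have set_w: "set w = {1..n}"
    using entry_bij by (simp add: bij_betw_def)
  then have perm: "is_permutation w"
    using ne finite_S len by (auto simp: is_permutation_def n_def intro: card_distinct)
  have emb: "embeds X Y R id (entry w) {1..length w} h"
    unfolding embeds_def len
  proof (intro conjI ballI)
    show "h ` R \<subseteq> {1..n}" using h by (simp add: bij_betw_def)
    fix p q assume pq: "p \<in> R" "q \<in> R"
    show "X p < X q \<longleftrightarrow> id (h p) < id (h q)"
      using rank_less_iff[OF finite_S pq, of X] by (simp add: h_def)
    have "entry w (h r) = rank Y R r" if "r \<in> R" for r
    proof -
      have "h r \<in> {1..n}" "inv_into R h (h r) = r"
        using that h bij_betwE bij_betw_inv_into_left by fast+
      then show ?thesis using entry_w by metis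
    qed
    then show "Y p < Y q \<longleftrightarrow> entry w (h p) < entry w (h q)"
      using rank_less_iff[OF finite_S pq, of Y] pq by simp
  qed
  have "fork_free id (entry w) {1..length w}"
  proof unfold_locales
    show "inj_on (entry w) {1..length w}"
      using entry_bij len by (simp add: bij_betw_def)
    have surj: "\<exists>p\<in>R. i = h p" if "i \<in> {1..length w}" for i
      using that h len by (auto simp: bij_betw_def)
    fix p b c d
    assume "p \<in> {1..length w}" "b \<in> {1..length w}" "c \<in> {1..length w}" "d \<in> {1..length w}"
      "below id (entry w) p b" "below id (entry w) b c" "below id (entry w) p d"
    then show "below id (entry w) b d \<or> below id (entry w) d c"
      using surj no_fork embeds_below[OF emb] by metis
  qed auto
  then show ?thesis
    using that emb perm fork_free_Av by blast
qed

definition amalgam ::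
  "('p \<Rightarrow> 'a::linorder) \<Rightarrow> ('p \<Rightarrow> 'b::linorder) \<Rightarrow> 'p set \<Rightarrow> 'p \<Rightarrow>
   ('q \<Rightarrow> 'c::linorder) \<Rightarrow> ('q \<Rightarrow> 'd::linorder) \<Rightarrow> 'q set \<Rightarrow> 'q \<Rightarrow> bool" where
  "amalgam X Y S a X' Y' T b \<longleftrightarrow>
     (\<exists>w\<in>Av [1, 4, 2, 3] [1, 3, 4, 2]. \<exists>f g.
        embeds X Y S id (entry w) {1..length w} f \<and>
        embeds X' Y' T id (entry w) {1..length w} g \<and> f a = g b)"

lemma amalgam_sym: "amalgam X Y S a X' Y' T b \<Longrightarrow> amalgam X' Y' T b X Y S a"
  unfolding amalgam_def by metis

lemma amalgamI:
  assumes "fork_free X'' Y'' R" "embeds X Y S X'' Y'' R f" "embeds X' Y' T X'' Y'' R g"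
    and "f a = g b" "a \<in> S"
  shows "amalgam X Y S a X' Y' T b"
proof -
  have "R \<noteq> {}" using assms by (auto simp: embeds_def)
  then obtain w h where w: "w \<in> Av [1, 4, 2, 3] [1, 3, 4, 2]"
    and h: "embeds X'' Y'' R id (entry w) {1..length w} h"
    using standardization[OF assms(1)] by blast
  show ?thesis
    unfolding amalgam_def
    using w embeds_comp[OF assms(2) h] embeds_comp[OF assms(3) h] assms(4)
    by (intro bexI[OF _ w] exI[of _ "h \<circ> f"] exI[of _ "h \<circ> g"]) simp
qed


section \<open>Inflating an interval\<close>

text \<open>
  An interval \<open>I\<close> around \<open>a\<close> with nothing of the rest of \<open>S\<close> below it. By the interval property,
  asking this for \<open>a\<close> is the same as asking it for every point of \<open>I\<close>.
\<close>

definition corner_interval ::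
  "('p \<Rightarrow> 'a::linorder) \<Rightarrow> ('p \<Rightarrow> 'b::linorder) \<Rightarrow> 'p set \<Rightarrow> 'p set \<Rightarrow> 'p \<Rightarrow> bool" where
  "corner_interval X Y S I a \<longleftrightarrow> I \<subseteq> S \<and> a \<in> I \<and>
     (\<forall>w\<in>S - I. \<not> below X Y w a \<and>
        (\<forall>q\<in>I. (X w < X q \<longleftrightarrow> X w < X a) \<and> (Y w < Y q \<longleftrightarrow> Y w < Y a)))"

text \<open>
  The amalgam \<open>w\<close> of \<open>I\<close> and \<open>T\<close> takes the place of \<open>I\<close>: its points share both coordinates of \<open>a\<close> and are
  told apart by a second, less significant coordinate. No old point is below a new one, and
  an old point is above a new one exactly if it is above \<open>a\<close>. So a fork that involves new points
  would give a fork in \<open>w\<close>, or one in \<open>S\<close> starting at \<open>a\<close>.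
\<close>

lemma amalgam_inflate:
  assumes S: "fork_free X Y S" and corner: "corner_interval X Y S I a"
    and am: "amalgam X Y I a X' Y' T b"
  shows "amalgam X Y S a X' Y' T b"
proof -
  interpret fork_free X Y S by (rule S)
  have I: "I \<subseteq> S" "a \<in> I"
    and none_below: "\<And>w. w \<in> S - I \<Longrightarrow> \<not> w \<prec> a"
    and X_interval: "\<And>w q. w \<in> S - I \<Longrightarrow> q \<in> I \<Longrightarrow> X w < X q \<longleftrightarrow> X w < X a"
    and Y_interval: "\<And>w q. w \<in> S - I \<Longrightarrow> q \<in> I \<Longrightarrow> Y w < Y q \<longleftrightarrow> Y w < Y a"
    using corner unfolding corner_interval_def by blast+
  obtain w f g where w: "w \<in> Av [1, 4, 2, 3] [1, 3, 4, 2]"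
    and f: "embeds X Y I id (entry w) {1..length w} f"
    and g: "embeds X' Y' T id (entry w) {1..length w} g" and fg: "f a = g b"
    using am by (auto simp: amalgam_def)
  define W where "W = {1..length w}"
  interpret W: fork_free id "entry w" W
    using w fork_free_Av by (auto simp: Av_def W_def)
  define R where "R = Inl ` (S - I) \<union> Inr ` W"
  define P where "P = case_sum (\<lambda>s. (X s, 0)) (\<lambda>i::nat. (X a, i))"
  define Q where "Q = case_sum (\<lambda>s. (Y s, 0)) (\<lambda>i. (Y a, entry w i))"
  have neq: "X s \<noteq> X a" "Y s \<noteq> Y a" "X a \<noteq> X s" "Y a \<noteq> Y s" if "s \<in> S - I" for s
    using that I X_eq[of s a] Y_eq[of s a] by auto
  have less_PQ:
    "P (Inl s) < P (Inl t) \<longleftrightarrow> X s < X t" "Q (Inl s) < Q (Inl t) \<longleftrightarrow> Y s < Y t"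
    "P (Inr i) < P (Inr j) \<longleftrightarrow> i < j" "Q (Inr i) < Q (Inr j) \<longleftrightarrow> entry w i < entry w j"
    for s t i j
    by (auto simp: P_def Q_def less_prod_def le_less)
  have less_PQ':
    "P (Inl s) < P (Inr i) \<longleftrightarrow> X s < X a" "Q (Inl s) < Q (Inr i) \<longleftrightarrow> Y s < Y a"
    "P (Inr i) < P (Inl s) \<longleftrightarrow> X a < X s" "Q (Inr i) < Q (Inl s) \<longleftrightarrow> Y a < Y s"
    if "s \<in> S - I" for s i
    using neq[OF that] by (auto simp: P_def Q_def less_prod_def le_less)
  have below_PQ:
    "below P Q (Inl s) (Inl t) \<longleftrightarrow> s \<prec> t"
    "below P Q (Inr i) (Inr j) \<longleftrightarrow> W.lt i j" for s t i j
    by (simp_all add: below_def less_PQ)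
  have below_PQ':
    "below P Q (Inr i) (Inl s) \<longleftrightarrow> a \<prec> s" "\<not> below P Q (Inl s) (Inr i)"
    if "s \<in> S - I" for s i
    using none_below[OF that] by (simp_all add: below_def less_PQ'[OF that])
  have aS: "a \<in> S" using I by blast
  have "fork_free P Q R"
  proof unfold_locales
    show "finite R" using finite_S W.finite_S by (simp add: R_def)
    show "inj_on P R"
      using neq by (auto simp: R_def inj_on_def P_def X_eq)
    show "inj_on Q R"
      using neq W.Y_eq by (auto simp: R_def inj_on_def Q_def Y_eq)
    fix p b c d
    assume R: "p \<in> R" "b \<in> R" "c \<in> R" "d \<in> R"
      and lt: "below P Q p b" "below P Q b c" "below P Q p d"
    show "below P Q b d \<or> below P Q d c"
    proof (cases p)
      case (Inl p')
      then obtain b' where b: "b = Inl b'"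
        using R lt below_PQ'(2) by (cases b) (auto simp: R_def)
      then obtain c' where c: "c = Inl c'"
        using R lt below_PQ'(2) by (cases c) (auto simp: R_def)
      obtain d' where d: "d = Inl d'"
        using Inl R lt below_PQ'(2) by (cases d) (auto simp: R_def)
      show ?thesis
        using Inl b c d R lt no_fork[of p' b' c' d'] by (auto simp: R_def below_PQ)
    next
      case p: (Inr p')
      show ?thesis
      proof (cases b)
        case b: (Inl b')
        then obtain c' where c: "c = Inl c'"
          using R lt below_PQ'(2) by (cases c) (auto simp: R_def)
        show ?thesis
          using p b c R lt no_fork[of a b' c' "projl d"] aS below_trans[of X Y a b' c']
          by (cases d) (auto simp: R_def below_PQ below_PQ')
      next
        case b: (Inr b')
        show ?thesis
          using p b R lt W.no_fork[of p' b' "projr c" "projr d"]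
          by (cases c; cases d) (auto simp: R_def below_PQ below_PQ')
      qed
    qed
  qed
  moreover have "embeds X Y S P Q R (\<lambda>s. if s \<in> I then Inr (f s) else Inl s)"
  proof -
    have "(P (Inl u) < P (Inr (f q)) \<longleftrightarrow> X u < X q) \<and> (P (Inr (f q)) < P (Inl u) \<longleftrightarrow> X q < X u) \<and>
      (Q (Inl u) < Q (Inr (f q)) \<longleftrightarrow> Y u < Y q) \<and> (Q (Inr (f q)) < Q (Inl u) \<longleftrightarrow> Y q < Y u)"
      if u: "u \<in> S - I" and q: "q \<in> I" for u q
    proof -
      have "X u \<noteq> X q" "Y u \<noteq> Y q"
        using u q I X_eq[of u q] Y_eq[of u q] by auto
      then show ?thesis
        using X_interval[OF u q] Y_interval[OF u q] neq[OF u] unfolding less_PQ'[OF u]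
        by (meson linorder_neqE order.asym)
    qed
    then show ?thesis
      using f by (auto simp: embeds_def R_def W_def less_PQ)
  qed
  moreover have "embeds X' Y' T P Q R (Inr \<circ> g)"
    using g by (auto simp: embeds_def R_def W_def less_PQ)
  ultimately show ?thesis
    by (rule amalgamI) (use fg I in auto)
qed

context fork_free
begin

lemma cap_above:
  assumes "a \<in> S" "p \<in> S" "p \<prec> a" "a \<notin> caps"
  obtains z where "z \<in> caps" "a \<prec> z"
proof -
  obtain q where "q \<in> S" "a \<prec> q"
    using assms by (auto simp: caps_def)
  then have "finite {z \<in> S. a \<prec> z}" "{z \<in> S. a \<prec> z} \<noteq> {}"
    using finite_S by auto
  from finite_max_key[OF this, of X] obtain z where z: "z \<in> {z \<in> S. a \<prec> z}"
    and max: "\<forall>q\<in>{z \<in> S. a \<prec> z}. X q \<le> X z" ..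
  have "\<not> z \<prec> q" if "q \<in> S" for q
  proof
    assume zq: "z \<prec> q"
    then have "a \<prec> q"
      using z below_trans[of X Y a z q] by blast
    then show False
      using max \<open>q \<in> S\<close> zq by (simp add: below_def not_le[symmetric])
  qed
  moreover have "p \<prec> z"
    using z assms(3) below_trans[of X Y p a z] by blast
  ultimately have "z \<in> caps"
    using z assms(2) unfolding caps_def by blast
  then show thesis
    using that z by blast
qed

text \<open>
  For a base point \<open>a\<close> that is not minimal, \<open>I\<close> is its component in the comparability graph of the
  base. A point \<open>w\<close> outside of \<open>I\<close> cannot separate two comparable points \<open>q \<prec> q'\<close> of \<open>I\<close>: it is below
  neither of them, as points below base points are base points, and if it is above \<open>q\<close> then it is a
  cap and hence above \<open>q'\<close>. Following paths from \<open>a\<close>, all of \<open>I\<close> lies on one side of \<open>w\<close> in either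
  coordinate. A cap above \<open>a\<close> is missing from \<open>I\<close>.
\<close>

lemma proper_interval:
  assumes a: "a \<in> S" "a \<notin> caps" and ne: "S \<noteq> {a}"
  shows "\<exists>I. I \<subset> S \<and> corner_interval X Y S I a"
proof (cases "\<exists>p\<in>S. p \<prec> a")
  case False
  then have "{a} \<subset> S \<and> corner_interval X Y S {a} a"
    using a ne by (auto simp: corner_interval_def)
  then show ?thesis ..
next
  case True
  then obtain z where z: "z \<in> caps" "a \<prec> z" using cap_above a by blast
  define E where "E = {(p, q). p \<in> base \<and> q \<in> base \<and> (p \<prec> q \<or> q \<prec> p)}"
  define I where "I = {q. (a, q) \<in> E\<^sup>*}"
  have aI: "a \<in> I" by (simp add: I_def)
  have step: "q' \<in> I" if "q \<in> I" "(q, q') \<in> E" for q q'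
    using that by (auto simp: I_def intro: rtrancl.rtrancl_into_rtrancl)
  have I_base: "I \<subseteq> base"
  proof
    fix q assume "q \<in> I"
    then have "(a, q) \<in> E\<^sup>*" by (simp add: I_def)
    then show "q \<in> base"
      by (cases rule: rtranclE) (use a base_or_caps in \<open>auto simp: E_def\<close>)
  qed
  have lower: "w \<in> I" if "q \<in> I" "w \<in> S" "w \<prec> q" for w q
  proof -
    have "w \<in> base" using that I_base base_or_caps capsD baseD by blast
    then show ?thesis using step[of q w] that I_base by (auto simp: E_def)
  qed
  have upper: "w \<in> caps" if "q \<in> I" "w \<in> S - I" "q \<prec> w" for w q
    using step[of q w] that I_base base_or_caps by (auto simp: E_def)
  have edge: "(X w < X q \<longleftrightarrow> X w < X q') \<and> (Y w < Y q \<longleftrightarrow> Y w < Y q')"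
    if q: "q \<in> I" "q' \<in> I" "q \<prec> q'" and w: "w \<in> S - I" for q q' w
  proof -
    have qS: "q \<in> S" "q' \<in> S" "q' \<in> base" using q I_base baseD by auto
    have nb: "\<not> w \<prec> q" "\<not> w \<prec> q'" using lower q w by blast+
    have na: "q' \<prec> w" if "q \<prec> w"
      using below_cap[of q q' w] upper[of q w] that q qS w by blast
    have ne: "X w \<noteq> X q" "X w \<noteq> X q'" "Y w \<noteq> Y q" "Y w \<noteq> Y q'"
      using X_eq Y_eq q w qS by auto
    have less: "X q < X q'" "Y q < Y q'"
      using q(3) by (auto simp: below_def)
    consider "X w < X q" | "X q < X w" "Y q < Y w" | "X q < X w" "Y w < Y q"
      using ne by fastforce
    then show ?thesis
    proof cases
      case 1
      then have "X w < X q'" using less by order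
      then have "Y q' < Y w" using nb(2) ne(4) by (auto simp: below_def)
      then show ?thesis using 1 \<open>X w < X q'\<close> less by auto
    next
      case 2
      then have "q' \<prec> w" using na by (simp add: below_def)
      then show ?thesis using 2 by (auto simp: below_def)
    next
      case 3
      then have "Y w < Y q'" using less by order
      then have "X q' < X w" using nb(2) ne(2) by (auto simp: below_def)
      then show ?thesis using 3 \<open>Y w < Y q'\<close> by auto
    qed
  qed
  have sides: "(X w < X q \<longleftrightarrow> X w < X a) \<and> (Y w < Y q \<longleftrightarrow> Y w < Y a)"
    if w: "w \<in> S - I" and q: "q \<in> I" for w q
  proof -
    from q have "(a, q) \<in> E\<^sup>*" by (simp add: I_def)
    then show ?thesis
    proof (induction rule: rtrancl_induct)
      case base
      show ?case by simp
    next
      case (step y q')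
      then have "y \<in> I" "q' \<in> I" by (auto simp: I_def)
      then show ?case
        using edge[of y q' w] edge[of q' y w] step w by (auto simp: E_def)
    qed
  qed
  have "\<not> w \<prec> a" if "w \<in> S - I" for w
    using lower[OF aI] that by blast
  moreover have "I \<subset> S"
    using I_base z baseD capsD by blast
  ultimately have "I \<subset> S \<and> corner_interval X Y S I a"
    using aI sides unfolding corner_interval_def by blast
  then show ?thesis ..
qed

end


section \<open>Merging along the staircase\<close>

text \<open>
  The merged configuration consists of \<open>S\<close> and of \<open>T\<close> without \<open>b\<close>, whose role is taken by \<open>a\<close>. Points are
  ordered horizontally by column and vertically by row; a tie between \<open>S\<close> and \<open>T\<close> is broken by the
  second coordinate, and the original coordinates come last.

  A base point of \<open>S\<close> at level \<open>i\<close> is below exactly those points of \<open>T\<close> that are caps of level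
  \<open>i - 1\<close>, and a base point of \<open>T\<close> at level \<open>i\<close> is below exactly those points of \<open>S\<close> that are caps of
  level \<open>i\<close>. In a fork \<open>p\<close>, \<open>q\<close>, \<open>c\<close>, \<open>d\<close> with \<open>q\<close> below \<open>c\<close>, the point \<open>q\<close> is not maximal, so \<open>p\<close> and
  \<open>q\<close> are base points of the same configuration and of the same level, whence they see the same
  points of the other one. If \<open>d\<close> belongs to that other one, it is therefore above \<open>q\<close>. If \<open>d\<close> is
  a cap of their own configuration, it is above \<open>q\<close> by \<open>below_cap\<close>. If it is a base point, it has
  the level of \<open>q\<close> as well, so it is below \<open>c\<close> whenever \<open>c\<close> belongs to the other one;
  a fork inside \<open>S\<close> or inside \<open>T\<close> is excluded from the start.
\<close>

lemma amalgam_caps: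
  fixes X Y :: "'p \<Rightarrow> nat" and X' Y' :: "'q \<Rightarrow> nat"
  assumes S: "fork_free X Y S" and T: "fork_free X' Y' T"
    and a: "a \<in> fork_free.caps X Y S" and b: "b \<in> fork_free.caps X' Y' T"
  shows "amalgam X Y S a X' Y' T b"
proof -
  interpret S: fork_free X Y S by (rule S)
  interpret T: fork_free X' Y' T by (rule T)
  note aS = S.capsD(1)[OF a] and bT = T.capsD(1)[OF b]
  obtain k where k_stair: "S.staircase k a"
    using S.staircase_exists[OF a] ..
  then have k: "\<And>p q. p \<in> S \<Longrightarrow> q \<in> S \<Longrightarrow> X p < X q \<Longrightarrow> k q \<le> k p"
    "\<And>p q. p \<in> S \<Longrightarrow> q \<in> S \<Longrightarrow> Y p < Y q \<Longrightarrow> S.row k p \<le> S.row k q"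
    and ka: "k a = 0"
    unfolding S.staircase_def by blast+
  obtain k' where k'_stair: "T.staircase k' b"
    using T.staircase_exists[OF b] ..
  then have k':
    "\<And>p q. p \<in> T \<Longrightarrow> q \<in> T \<Longrightarrow> X' p < X' q \<Longrightarrow> k' q \<le> k' p"
    "\<And>p q. p \<in> T \<Longrightarrow> q \<in> T \<Longrightarrow> Y' p < Y' q \<Longrightarrow> T.row k' p \<le> T.row k' q"
    and col_b: "\<And>p. p \<in> T \<Longrightarrow> 0 \<le> k' p \<longleftrightarrow> X' p \<le> X' b"
    and row_b: "\<And>p. p \<in> T \<Longrightarrow> 1 \<le> T.row k' p \<longleftrightarrow> Y' b \<le> Y' p"
    unfolding T.staircase_def by blast+
  define R where "R = Inl ` S \<union> Inr ` (T - {b})"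
  define P where "P = case_sum (\<lambda>s. (- k s, 1::nat, X s)) (\<lambda>t. (- k' t, 0, X' t))"
  define Q where "Q = case_sum (\<lambda>s. (S.row k s, 0::nat, Y s)) (\<lambda>t. (T.row k' t, 1, Y' t))"
  have P_SS: "P (Inl p) < P (Inl q) \<longleftrightarrow> X p < X q" if "p \<in> S" "q \<in> S" for p q
    using k(1)[of p q] k(1)[of q p] that S.X_eq[of p q]
    by (cases "X p" "X q" rule: linorder_cases) (auto simp: P_def less_prod_def le_less)
  have Q_SS: "Q (Inl p) < Q (Inl q) \<longleftrightarrow> Y p < Y q" if "p \<in> S" "q \<in> S" for p q
    using k(2)[of p q] k(2)[of q p] that S.Y_eq[of p q]
    by (cases "Y p" "Y q" rule: linorder_cases) (auto simp: Q_def less_prod_def le_less)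
  have P_TT: "P (Inr p) < P (Inr q) \<longleftrightarrow> X' p < X' q" if "p \<in> T" "q \<in> T" for p q
    using k'(1)[of p q] k'(1)[of q p] that T.X_eq[of p q]
    by (cases "X' p" "X' q" rule: linorder_cases) (auto simp: P_def less_prod_def le_less)
  have Q_TT: "Q (Inr p) < Q (Inr q) \<longleftrightarrow> Y' p < Y' q" if "p \<in> T" "q \<in> T" for p q
    using k'(2)[of p q] k'(2)[of q p] that T.Y_eq[of p q]
    by (cases "Y' p" "Y' q" rule: linorder_cases) (auto simp: Q_def less_prod_def le_less)
  have cross:
    "P (Inl s) < P (Inr t) \<longleftrightarrow> k' t < k s" "P (Inr t) < P (Inl s) \<longleftrightarrow> k s \<le> k' t"
    "Q (Inl s) < Q (Inr t) \<longleftrightarrow> S.row k s \<le> T.row k' t"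
    "Q (Inr t) < Q (Inl s) \<longleftrightarrow> T.row k' t < S.row k s" for s t
    by (auto simp: P_def Q_def less_prod_def le_less)
  have below_SS: "below P Q (Inl p) (Inl q) \<longleftrightarrow> S.lt p q" if "p \<in> S" "q \<in> S" for p q
    using that by (simp add: below_def P_SS Q_SS)
  have below_TT: "below P Q (Inr p) (Inr q) \<longleftrightarrow> T.lt p q" if "p \<in> T" "q \<in> T" for p q
    using that by (simp add: below_def P_TT Q_TT)
  have below_ST: "below P Q (Inl s) (Inr t) \<longleftrightarrow> s \<notin> S.caps \<and> t \<in> T.caps \<and> k' t = k s - 1" for s t
    by (auto simp: below_def cross S.row_def T.row_def)
  have below_TS: "below P Q (Inr t) (Inl s) \<longleftrightarrow> t \<notin> T.caps \<and> s \<in> S.caps \<and> k' t = k s" for s t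
    by (auto simp: below_def cross S.row_def T.row_def)
  note S_base = S.same_level[OF k_stair] and T_base = T.same_level[OF k'_stair]
  have "fork_free P Q R"
  proof unfold_locales
    show "finite R" using S.finite_S T.finite_S by (simp add: R_def)
    show "inj_on P R"
      by (auto simp: R_def inj_on_def P_def S.X_eq T.X_eq)
    show "inj_on Q R"
      by (auto simp: R_def inj_on_def Q_def S.Y_eq T.Y_eq)
    fix p q c d
    assume R: "p \<in> R" "q \<in> R" "c \<in> R" "d \<in> R"
      and lt: "below P Q p q" "below P Q q c" "below P Q p d"
    consider (S) "p \<in> Inl ` S" "q \<in> Inl ` S" | (T) "p \<in> Inr ` T" "q \<in> Inr ` T"
      | (ST) "p \<in> Inl ` S" "q \<in> Inr ` T" | (TS) "p \<in> Inr ` T" "q \<in> Inl ` S"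
      using R(1,2) unfolding R_def by blast
    then show "below P Q q d \<or> below P Q d c"
    proof cases
      case pq: S
      then obtain p' q' where S: "p = Inl p'" "q = Inl q'" "p' \<in> S" "q' \<in> S"
        by blast
      have q': "q' \<notin> S.caps"
        using S lt R S.capsD by (auto simp: R_def below_SS below_ST)
      then have kq: "k q' = k p'" "q' \<in> S.base"
        using S lt S_base by (auto simp: below_SS S.base_def)
      show ?thesis
      proof (cases d)
        case (Inr d')
        then show ?thesis
          using S lt q' kq by (simp add: below_ST)
      next
        case d: (Inl d')
        then have d': "d' \<in> S" "S.lt p' d'"
          using R lt S by (auto simp: R_def below_SS)
        show ?thesis
        proof (cases c)
          case (Inl c')
          then show ?thesis
            using S d d' R lt S.no_fork[of p' q' c' d'] by (auto simp: R_def below_SS)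
        next
          case c: (Inr c')
          show ?thesis
          proof (cases "d' \<in> S.caps")
            case True
            then have "S.lt q' d'"
              using S.below_cap[of p' q' d'] S lt kq d' by (auto simp: below_SS)
            then show ?thesis using S d d' by (simp add: below_SS)
          next
            case False
            then have "k d' = k p'" using S d' S_base by blast
            then show ?thesis
              using S c d lt kq False by (simp add: below_ST)
          qed
        qed
      qed
    next
      case pq: T
      then obtain p' q' where T: "p = Inr p'" "q = Inr q'" "p' \<in> T" "q' \<in> T"
        by blast
      have q': "q' \<notin> T.caps"
        using T lt R T.capsD by (auto simp: R_def below_TT below_TS)
      then have kq: "k' q' = k' p'" "q' \<in> T.base"
        using T lt T_base by (auto simp: below_TT T.base_def)
      show ?thesis
      proof (cases d)
        case (Inl d')
        then show ?thesis
          using T lt q' kq by (simp add: below_TS)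
      next
        case d: (Inr d')
        then have d': "d' \<in> T" "T.lt p' d'"
          using R lt T by (auto simp: R_def below_TT)
        show ?thesis
        proof (cases c)
          case (Inr c')
          then show ?thesis
            using T d d' R lt T.no_fork[of p' q' c' d'] by (auto simp: R_def below_TT)
        next
          case c: (Inl c')
          show ?thesis
          proof (cases "d' \<in> T.caps")
            case True
            then have "T.lt q' d'"
              using T.below_cap[of p' q' d'] T lt kq d' by (auto simp: below_TT)
            then show ?thesis using T d d' by (simp add: below_TT)
          next
            case False
            then have "k' d' = k' p'" using T d' T_base by blast
            then show ?thesis
              using T c d lt kq False by (simp add: below_TS)
          qed
        qed
      qed
    next
      case ST
      then show ?thesis
        using R lt T.capsD by (cases c) (auto simp: R_def below_ST below_TS below_TT)
    next
      case TS
      then show ?thesis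
        using R lt S.capsD by (cases c) (auto simp: R_def below_ST below_TS below_SS)
    qed
  qed
  moreover have "embeds X Y S P Q R Inl"
    by (auto simp: embeds_def R_def P_SS Q_SS)
  moreover have "embeds X' Y' T P Q R (\<lambda>t. if t = b then Inl a else Inr t)"
  proof -
    have row_a: "S.row k a = 1" using a ka by (simp add: S.row_def)
    \<comment> \<open>Here it matters that \<open>b\<close> is the corner of its cell: no point of \<open>T\<close> in the column of \<open>a\<close> has to be
      to the right of \<open>a\<close>, and none in its row has to be below \<open>a\<close>.\<close>
    have Pa: "P (Inl a) < P (Inr t) \<longleftrightarrow> X' b < X' t" "P (Inr t) < P (Inl a) \<longleftrightarrow> X' t < X' b"
      if "t \<in> T - {b}" for t
      using col_b[of t] that T.X_eq[of t b] bT by (auto simp: cross ka)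
    have Qa: "Q (Inl a) < Q (Inr t) \<longleftrightarrow> Y' b < Y' t" "Q (Inr t) < Q (Inl a) \<longleftrightarrow> Y' t < Y' b"
      if "t \<in> T - {b}" for t
      using row_b[of t] that T.Y_eq[of t b] bT by (auto simp: cross row_a)
    show ?thesis
      using aS by (auto simp: embeds_def R_def Pa Qa P_TT Q_TT)
  qed
  ultimately show ?thesis
    by (rule amalgamI) (use aS in auto)
qed


section \<open>Amalgamation at arbitrary points\<close>

lemma amalgam_singleton:
  assumes T: "fork_free X' Y' T" and b: "b \<in> T"
  shows "amalgam X Y {a} a X' Y' T b"
  by (rule amalgamI[of X' Y' T _ _ _ "\<lambda>_. b" _ _ _ id]) (use assms in \<open>auto simp: embeds_def\<close>)

lemma amalgam_exists:
  fixes X Y :: "'p \<Rightarrow> nat" and X' Y' :: "'q \<Rightarrow> nat"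
  assumes "fork_free X Y S" "fork_free X' Y' T" "a \<in> S" "b \<in> T"
  shows "amalgam X Y S a X' Y' T b"
  using assms
proof (induction "card S + card T" arbitrary: S T rule: less_induct)
  case less
  interpret S: fork_free X Y S by (rule less.prems)
  interpret T: fork_free X' Y' T by (rule less.prems)
  consider (single) "S = {a} \<or> T = {b}" | (S) "S \<noteq> {a}" "a \<notin> S.caps"
    | (T) "T \<noteq> {b}" "b \<notin> T.caps" | (caps) "a \<in> S.caps" "b \<in> T.caps"
    by auto
  then show ?case
  proof cases
    case single
    then show ?thesis
      using amalgam_singleton[OF less.prems(2,4)]
        amalgam_sym[OF amalgam_singleton[OF less.prems(1,3)]] by auto
  next
    case S
    obtain I where I: "I \<subset> S" "corner_interval X Y S I a"
      using S.proper_interval[OF less.prems(3) S(2,1)] by blast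
    have "amalgam X Y I a X' Y' T b"
    proof (rule less.hyps)
      show "card I + card T < card S + card T"
        using I(1) S.finite_S by (simp add: psubset_card_mono)
      show "fork_free X Y I"
        using fork_free_subset[OF less.prems(1)] I(1) by blast
      show "a \<in> I"
        using I(2) by (simp add: corner_interval_def)
    qed (rule less.prems)+
    then show ?thesis
      by (rule amalgam_inflate[OF less.prems(1) I(2)])
  next
    case T
    obtain I where I: "I \<subset> T" "corner_interval X' Y' T I b"
      using T.proper_interval[OF less.prems(4) T(2,1)] by blast
    have "amalgam X Y S a X' Y' I b"
    proof (rule less.hyps)
      show "card S + card I < card S + card T"
        using I(1) T.finite_S by (simp add: psubset_card_mono)
      show "fork_free X' Y' I"
        using fork_free_subset[OF less.prems(2)] I(1) by blast
      show "b \<in> I"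
        using I(2) by (simp add: corner_interval_def)
    qed (rule less.prems)+
    then show ?thesis
      by (rule amalgam_sym[OF amalgam_inflate[OF less.prems(2) I(2) amalgam_sym]])
  next
    case caps
    then show ?thesis
      by (rule amalgam_caps[OF less.prems(1,2)])
  qed
qed

theorem corollary5p6:
  shows "one_amalgamable (Av [1, 4, 2, 3] [1, 3, 4, 2])"
  unfolding one_amalgamable_def
proof (intro ballI allI impI)
  fix t1 t2 f1 f2
  assume t: "t1 \<in> Av [1, 4, 2, 3] [1, 3, 4, 2]" "t2 \<in> Av [1, 4, 2, 3] [1, 3, 4, 2]"
    and f: "embedding f1 [1] t1 \<and> embedding f2 [1] t2"
  have "fork_free id (entry t1) {1..length t1}" "fork_free id (entry t2) {1..length t2}"
    using t fork_free_Av by (auto simp: Av_def)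
  moreover have "f1 1 \<in> {1..length t1}" "f2 1 \<in> {1..length t2}"
    using f by (auto simp: embedding_def)
  ultimately have "amalgam id (entry t1) {1..length t1} (f1 1) id (entry t2) {1..length t2} (f2 1)"
    by (rule amalgam_exists)
  then show "\<exists>s\<in>Av [1, 4, 2, 3] [1, 3, 4, 2]. \<exists>g1 g2. embedding g1 t1 s \<and> embedding g2 t2 s \<and>
      (\<forall>i\<in>{1..length [1::nat]}. (g1 \<circ> f1) i = (g2 \<circ> f2) i)"
    by (simp add: amalgam_def embedding_iff_embeds)
qed

end
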